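(* Let $F$ be a field of characteristic $0$. Let $R$ be a Rota--Baxter operator of weight $1$ on $F[x,y]$ such that $R(x^n y^m) = \alpha_{n,m} y^m$ for some $\alpha_{n,m}\in F$ ($n,m\in\mathbb{N}$) and $\mathrm{Im}\,R\not\subseteq F1$. Then there exist $\beta,\gamma\in F$ such that $R$ has the following form: $$R(x^n y^m) = \begin{cases} -\beta^n y^m, & m>0, \\ \theta\gamma^n, & m=0, \end{cases}$$ where $\theta\in\{0,-1\}$.
   Context: $\mathbb{N}=\{0,1,2,\ldots\}$, and $\mu^0=1$ for every $\mu\in F$ (in particular $0^0=1$). $F1$ is the set of constant polynomials. A linear operator $R$ on an algebra $A$ over $F$ is a Rota--Baxter operator of weight $\lambda\in F$ if $R(a)R(b)=R\big(R(a)b+aR(b)+\lambda ab\big)$ for all $a,b\in A$. *)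

theory Defs
  imports "HOL-Computational_Algebra.Polynomial"
begin

locale algebra_over = vector_space scale
  for scale :: "'f::field \<Rightarrow> 'a::ring \<Rightarrow> 'a" +
  assumes scale_mult_left: "scale c a * b = scale c (a * b)"
    and scale_mult_right: "a * scale c b = scale c (a * b)"

locale rota_baxter_operator =
  algebra_over scale + Vector_Spaces.linear scale scale R
  for scale :: "'f::field \<Rightarrow> 'a::ring \<Rightarrow> 'a"
    and wt :: 'f
    and R :: "'a \<Rightarrow> 'a" +
  assumes rota_baxter: "R a * R b = R (R a * b + a * R b + scale wt (a * b))"

text \<open>\<open>F[x,y]\<close> is represented as \<open>F[x][y]\<close>: the outer polynomial is in \<open>y\<close>, its coefficients
  are polynomials in \<open>x\<close>.\<close>

type_synonym 'a poly2 = "'a poly poly"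

definition const2 :: "'a::zero \<Rightarrow> 'a poly2" where
  "const2 c = [:[:c:]:]"

definition X :: "'a::comm_semiring_1 poly2" where
  "X = [:[:0, 1:]:]"

definition Y :: "'a::comm_semiring_1 poly2" where
  "Y = [:0, 1:]"

definition scale2 :: "'a::comm_semiring_0 \<Rightarrow> 'a poly2 \<Rightarrow> 'a poly2" where
  "scale2 c p = smult [:c:] p"

lemma scale2_eq: "scale2 c p = const2 c * p"
  by (simp add: scale2_def const2_def)

lemma monomial_eq: "X ^ n * Y ^ m = monom (monom (1 :: 'a::comm_semiring_1) n) m"
proof -
  have "X ^ n = [:monom (1 :: 'a) n:]"
    by (induction n) (simp_all add: X_def one_pCons monom_Suc monom_0)
  moreover have "Y ^ m = monom (1 :: 'a poly) m"
    by (simp add: Y_def monom_altdef)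
  ultimately show ?thesis
    by (simp add: smult_monom)
qed

interpretation poly2: algebra_over "scale2 :: 'a::field \<Rightarrow> 'a poly2 \<Rightarrow> 'a poly2"
proof
  fix c d :: 'a and p q :: "'a poly2"
  have add: "[:c + d:] = [:c:] + [:d:]" and mult: "[:c * d:] = [:c:] * [:d:]"
    by simp_all
  show "scale2 c (p + q) = scale2 c p + scale2 c q"
    by (simp add: scale2_def smult_add_right)
  show "scale2 (c + d) p = scale2 c p + scale2 d p"
    unfolding scale2_def add by (rule smult_add_left)
  show "scale2 c (scale2 d p) = scale2 (c * d) p"
    unfolding scale2_def mult by (rule smult_smult)
  show "scale2 1 p = p"
    by (simp add: scale2_def flip: one_pCons)
  show "scale2 c p * q = scale2 c (p * q)" "p * scale2 c q = scale2 c (p * q)"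
    by (simp_all add: scale2_def)
qed

end

theory Submission imports Defs begin

text \<open>
  On monomials the Rota--Baxter identity is a system of equations for the coefficients
  \<open>\<alpha> n m\<close>. In terms of \<open>\<chi>\<^sub>m(n) = - \<alpha> n m\<close>, the equations in which one of the two
  monomials has \<open>y\<close>-degree \<open>0\<close> say that every \<open>\<chi>\<^sub>m\<close> is a multiplicative function on
  \<open>(\<nat>, +)\<close>, so it is either zero or \<open>n \<mapsto> \<mu>\<^sup>n\<close> for a scalar \<open>\<mu>\<close>. Given this, the
  remaining equations factor as
  \<open>(\<chi>\<^sub>m(n) - \<chi>\<^sub>m\<^sub>+\<^sub>l(n)) (\<chi>\<^sub>l(k) - \<chi>\<^sub>m\<^sub>+\<^sub>l(k)) = 0\<close> for all \<open>n\<close> and \<open>k\<close>.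
  Since \<open>n\<close> and \<open>k\<close> vary independently, \<open>\<chi>\<^sub>m\<^sub>+\<^sub>l\<close> is one of the functions
  \<open>\<chi>\<^sub>m\<close>, \<open>\<chi>\<^sub>l\<close>. Adding \<open>1\<close> repeatedly, all \<open>\<chi>\<^sub>m\<close> with \<open>m > 0\<close> coincide with
  \<open>\<chi>\<^sub>1\<close>. If \<open>\<chi>\<^sub>1\<close> were zero, the image of \<open>R\<close> would consist of constants; hence
  \<open>\<chi>\<^sub>1(n) = \<beta>\<^sup>n\<close>. The function \<open>\<chi>\<^sub>0\<close> is independent of \<open>\<chi>\<^sub>1\<close> and may vanish, which
  gives the two values of \<open>\<theta>\<close>.
\<close>

lemma scale2_Y_power_cancel:
  fixes c d :: "'a::field"
  shows "scale2 c (Y ^ m) = scale2 d (Y ^ m) \<longleftrightarrow> c = d"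
proof -
  have "(Y :: 'a poly2) ^ m \<noteq> 0"
    by (simp add: Y_def)
  then show ?thesis
    by auto
qed

lemma monom_monom_eq_scale2:
  "monom (monom c n) m = scale2 c (X ^ n * Y ^ m :: 'a::field poly2)"
  by (simp add: monomial_eq scale2_def smult_monom)

lemma span_monomials:
  "p \<in> poly2.span (range (\<lambda>(n, m). X ^ n * Y ^ m :: 'a::field poly2))"
    (is "p \<in> ?S")
proof -
  have monomial: "monom (monom c n) m \<in> ?S" for c :: 'a and n m
    unfolding monom_monom_eq_scale2
    by (intro poly2.span_scale poly2.span_base) auto
  have "monom q m \<in> ?S" for q :: "'a poly" and m
  proof -
    have "monom q m = monom (\<Sum>n\<le>degree q. monom (coeff q n) n) m"
      by (simp add: poly_as_sum_of_monoms)
    also have "\<dots> = (\<Sum>n\<le>degree q. monom (monom (coeff q n) n) m)"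
      by (intro poly_eqI) (simp add: coeff_sum)
    finally show ?thesis
      by (simp add: monomial poly2.span_sum)
  qed
  then have "(\<Sum>m\<le>degree p. monom (coeff p m) m) \<in> ?S"
    by (intro poly2.span_sum)
  then show ?thesis
    by (simp add: poly_as_sum_of_monoms)
qed

lemma subspace_range_const2: "poly2.subspace (range (const2 :: 'a::field \<Rightarrow> 'a poly2))"
proof (rule poly2.subspaceI)
  show "0 \<in> range (const2 :: 'a \<Rightarrow> 'a poly2)"
    by (rule range_eqI[of _ _ 0]) (simp add: const2_def)
next
  fix p q :: "'a poly2"
  assume "p \<in> range const2" and "q \<in> range const2"
  then obtain c d where "p = const2 c" and "q = const2 d"
    by blast
  then show "p + q \<in> range const2"
    by (intro range_eqI[of _ _ "c + d"]) (simp add: const2_def)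
next
  fix c :: 'a and p :: "'a poly2"
  assume "p \<in> range const2"
  then obtain d where "p = const2 d"
    by blast
  then show "scale2 c p \<in> range const2"
    by (intro range_eqI[of _ _ "c * d"]) (simp add: const2_def scale2_def)
qed

lemma linear_image_subset_of_monomials:
  fixes R :: "'a::field poly2 \<Rightarrow> 'a poly2"
  assumes "Vector_Spaces.linear scale2 scale2 R"
    and "poly2.subspace V"
    and "\<And>n m. R (X ^ n * Y ^ m) \<in> V"
  shows "range R \<subseteq> V"
proof -
  interpret R: Vector_Spaces.linear scale2 scale2 R
    by fact
  have "R p \<in> V" for p
    using span_monomials[of p]
  proof (induction rule: poly2.span_induct)
    show "poly2.subspace {p. R p \<in> V}"
      using assms(2) by (simp add: poly2.subspace_def R.add R.scale R.zero)
  next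
    fix q :: "'a poly2"
    assume "q \<in> range (\<lambda>(n, m). X ^ n * Y ^ m)"
    then show "R q \<in> V"
      using assms(3) by auto
  qed
  then show ?thesis
    by blast
qed

text \<open>The product of two monomial images has \<open>y\<close>-degree \<open>m + l\<close>, and \<open>R\<close> keeps the
  \<open>y\<close>-degree, so both sides of the Rota--Baxter identity are multiples of \<open>y\<^sup>m\<^sup>+\<^sup>l\<close>.\<close>

lemma rota_baxter_coeffs:
  fixes R :: "'a::field poly2 \<Rightarrow> 'a poly2"
  assumes "rota_baxter_operator scale2 1 R"
    and R_monomial: "\<And>n m. R (X ^ n * Y ^ m) = scale2 (\<alpha> n m) (Y ^ m)"
  shows "\<alpha> n m * \<alpha> k l
    = \<alpha> n m * \<alpha> k (m + l) + \<alpha> k l * \<alpha> n (m + l) + \<alpha> (n + k) (m + l)"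
proof -
  interpret R: rota_baxter_operator scale2 1 R
    by fact
  let ?a = "X ^ n * Y ^ m :: 'a poly2" and ?b = "X ^ k * Y ^ l :: 'a poly2"
  have "scale2 (\<alpha> n m * \<alpha> k l) (Y ^ (m + l)) = R ?a * R ?b"
    unfolding R_monomial
    by (simp add: poly2.scale_mult_left poly2.scale_mult_right power_add mult.commute)
  also have "\<dots> = R (R ?a * ?b + ?a * R ?b + scale2 1 (?a * ?b))"
    by (rule R.rota_baxter)
  also have "R ?a * ?b + ?a * R ?b + scale2 1 (?a * ?b)
      = scale2 (\<alpha> n m) (X ^ k * Y ^ (m + l)) + scale2 (\<alpha> k l) (X ^ n * Y ^ (m + l))
        + X ^ (n + k) * Y ^ (m + l)"
    unfolding R_monomial
    by (simp add: poly2.scale_mult_left poly2.scale_mult_right power_add mult_ac)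
  also have "R \<dots> = scale2
      (\<alpha> n m * \<alpha> k (m + l) + \<alpha> k l * \<alpha> n (m + l) + \<alpha> (n + k) (m + l)) (Y ^ (m + l))"
    by (simp add: R.add R.scale R_monomial poly2.scale_left_distrib)
  finally show ?thesis
    by (simp only: scale2_Y_power_cancel)
qed

lemma multiplicative_sequence_eq:
  fixes f :: "nat \<Rightarrow> 'a::comm_monoid_mult"
  assumes "\<And>n k. f (n + k) = f n * f k"
  shows "f n = f 0 * f 1 ^ n"
proof (induction n)
  case (Suc n)
  then show ?case
    using assms[of n 1] by (simp add: mult_ac)
qed simp

text \<open>Because \<open>f 2 \<in> {f 1, f 1}\<close> and \<open>f (m + 1) \<in> {f m, f 1}\<close>, no new value can appear
  after \<open>f 1\<close>. The value \<open>f 0\<close> is not constrained by this.\<close>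

lemma selective_sequence_const:
  fixes f :: "nat \<Rightarrow> 'b"
  assumes "\<And>m l. f (m + l) = f m \<or> f (m + l) = f l"
    and "m > 0"
  shows "f m = f 1"
  using \<open>m > 0\<close>
proof (induction m rule: nat_induct_non_zero)
  case (Suc m)
  then show ?case
    using assms(1)[of m 1] by auto
qed simp

theorem lemma6p1:
  fixes R :: "'a::field_char_0 poly2 \<Rightarrow> 'a poly2"
    and \<alpha> :: "nat \<Rightarrow> nat \<Rightarrow> 'a"
  assumes "rota_baxter_operator scale2 1 R"
    and "\<And>n m. R (X ^ n * Y ^ m) = scale2 (\<alpha> n m) (Y ^ m)"
    and "\<not> range R \<subseteq> range const2"
  shows "\<exists>\<beta> \<gamma> \<theta> :: 'a. \<theta> \<in> {0, -1} \<and>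
    (\<forall>n m. R (X ^ n * Y ^ m) =
      (if m > 0 then scale2 (- (\<beta> ^ n)) (Y ^ m) else const2 (\<theta> * \<gamma> ^ n)))"
proof -
  interpret R: rota_baxter_operator scale2 1 R
    by fact
  define \<chi> where "\<chi> m n = - \<alpha> n m" for m n
  have \<alpha>_eq: "\<alpha> n m = - \<chi> m n" for n m
    by (simp add: \<chi>_def)
  have rb: "\<chi> m n * \<chi> l k
      = \<chi> m n * \<chi> (m + l) k + \<chi> l k * \<chi> (m + l) n - \<chi> (m + l) (n + k)" for n m k l
    using rota_baxter_coeffs[OF assms(1,2), of n m k l] by (simp add: \<alpha>_eq)

  \<comment> \<open>For \<open>l = 0\<close> the product \<open>\<chi> m n * \<chi> 0 k\<close> occurs on both sides and cancels.\<close>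
  have \<chi>_add: "\<chi> m (n + k) = \<chi> m n * \<chi> m k" for m n k
    using rb[of m n 0 k] by (simp add: algebra_simps)
  have \<chi>_power: "\<chi> m n = \<chi> m 0 * \<chi> m 1 ^ n" for m n
    using \<chi>_add by (rule multiplicative_sequence_eq)
  have \<chi>_0: "\<chi> m 0 \<in> {0, 1}" for m
    using \<chi>_add[of m 0 0] by simp

  \<comment> \<open>This is an equality of functions, so each of its failures has a witness of its own.\<close>
  have "\<chi> (m + l) = \<chi> m \<or> \<chi> (m + l) = \<chi> l" for m l
  proof (rule ccontr)
    assume "\<not> ?thesis"
    then obtain n k where "\<chi> (m + l) n \<noteq> \<chi> m n" and "\<chi> (m + l) k \<noteq> \<chi> l k"
      by (auto simp: fun_eq_iff)
    moreover have "(\<chi> m n - \<chi> (m + l) n) * (\<chi> l k - \<chi> (m + l) k) = 0"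
      using rb[of m n l k] by (simp add: \<chi>_add algebra_simps)
    ultimately show False
      by simp
  qed
  then have \<chi>_const: "\<chi> m = \<chi> 1" if "m > 0" for m
    using that by (rule selective_sequence_const)

  have R_const: "R (X ^ n * Y ^ 0) = const2 (- \<chi> 0 n)" for n
    unfolding assms(2) \<alpha>_eq by (simp add: scale2_eq)
  have "\<chi> 1 0 \<noteq> 0"
  proof
    assume "\<chi> 1 0 = 0"
    then have \<chi>_zero: "\<chi> m n = 0" if "m > 0" for m n
      using that \<chi>_power[of 1 n] \<chi>_const[of m] by simp
    have "R (X ^ n * Y ^ m) = const2 (if m = 0 then - \<chi> 0 n else 0)" for n m
    proof (cases "m = 0")
      case True
      then show ?thesis
        using R_const by simp
    next
      case False
      then show ?thesis
        unfolding assms(2) \<alpha>_eq by (simp add: \<chi>_zero const2_def)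
    qed
    then have "range R \<subseteq> range const2"
      by (intro linear_image_subset_of_monomials[OF R.linear_axioms subspace_range_const2]) simp
    with assms(3) show False
      by simp
  qed
  then have "\<chi> 1 0 = 1"
    using \<chi>_0[of 1] by simp
  then have \<chi>_pos: "\<chi> m n = \<chi> 1 1 ^ n" if "m > 0" for m n
    using \<chi>_power[of 1 n] \<chi>_const[OF that] by simp

  show ?thesis
  proof (intro exI conjI allI)
    show "- \<chi> 0 0 \<in> {0, -1}"
      using \<chi>_0[of 0] by auto
    fix n m
    show "R (X ^ n * Y ^ m) = (if m > 0 then scale2 (- (\<chi> 1 1 ^ n)) (Y ^ m)
        else const2 (- \<chi> 0 0 * \<chi> 0 1 ^ n))"
    proof (cases "m > 0")
      case True
      then show ?thesis
        unfolding assms(2) \<alpha>_eq by (simp add: \<chi>_pos[OF True])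
    next
      case False
      then show ?thesis
        using R_const[of n] \<chi>_power[of 0 n] by simp
    qed
  qed
qed

end
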